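(* Let $\gamma\neq0$ and $\mu>0$. The function $\tilde u^{\gamma,\mu}_1=\tilde g^\gamma_\mu$, where $\tilde g^\gamma_\mu(x,t)=g^\gamma_\mu(x,t^{1/\gamma})$ is the distribution of the generalized Gamma process, satisfies $$\frac{\partial}{\partial t}\tilde u^{\gamma,\mu}_1=\frac{1}{\gamma^2}\left(\frac{\partial}{\partial x}x^{2-\gamma}\frac{\partial}{\partial x}-(\gamma\mu-1)\frac{\partial}{\partial x}x^{1-\gamma}\right)\tilde u^{\gamma,\mu}_1,\qquad x>0,\ t>0.$$
   Context: For $\gamma\neq0$, $\mu>0$, $g^\gamma_\mu(x,t)=|\gamma|\,\frac{x^{\gamma\mu-1}}{t^{\gamma\mu}\Gamma(\mu)}\exp\{-x^\gamma/t^\gamma\}$, $x,t>0$; hence $\tilde g^\gamma_\mu(x,t)=|\gamma|\,\frac{x^{\gamma\mu-1}}{t^{\mu}\Gamma(\mu)}\exp\{-x^\gamma/t\}$. The generalized Gamma process has one-dimensional densities $g^\gamma_\mu(\cdot,t)$. The operator on the right acts as composition: $\frac{1}{\gamma^2}\left(\frac{\partial}{\partial x}\big(x^{2-\gamma}\frac{\partial f}{\partial x}\big)-(\gamma\mu-1)\frac{\partial}{\partial x}\big(x^{1-\gamma}f\big)\right)$. *)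

theory Defs
  imports "HOL-Analysis.Analysis"
begin

definition gen_gamma_density :: "real \<Rightarrow> real \<Rightarrow> real \<Rightarrow> real \<Rightarrow> real" where
  "gen_gamma_density \<gamma> \<mu> x t =
     \<bar>\<gamma>\<bar> * (x powr (\<gamma> * \<mu> - 1) / (t powr (\<gamma> * \<mu>) * Gamma \<mu>)) * exp (- (x powr \<gamma> / t powr \<gamma>))"

definition gen_gamma_density_tilde :: "real \<Rightarrow> real \<Rightarrow> real \<Rightarrow> real \<Rightarrow> real" where
  "gen_gamma_density_tilde \<gamma> \<mu> x t = gen_gamma_density \<gamma> \<mu> x (t powr (1 / \<gamma>))"

(* The juxtapositions d/dx x^(2-\<gamma>) d/dx and d/dx x^(1-\<gamma>) are compositions of operators:
   the power multiplies the function before the outer derivative is taken.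
   The operator is meant at points x > 0; deriv is local, so the values of powr
   at nonpositive arguments are irrelevant there.  deriv is unspecified
   where the derivative does not exist, so differentiability must be stated separately. *)
definition gen_gamma_operator :: "real \<Rightarrow> real \<Rightarrow> (real \<Rightarrow> real) \<Rightarrow> real \<Rightarrow> real" where
  "gen_gamma_operator \<gamma> \<mu> f x =
     1 / \<gamma>\<^sup>2 * (deriv (\<lambda>y. y powr (2 - \<gamma>) * deriv f y) x
               - (\<gamma> * \<mu> - 1) * deriv (\<lambda>y. y powr (1 - \<gamma>) * f y) x)"

end

(* The first order terms cancel in the flux: x^(2-\<gamma>) u' - (\<gamma>\<mu> - 1) x^(1-\<gamma>) u = - (\<gamma>/t) x u.
   Hence the right-hand side of the equation is - (x u)' / (\<gamma> t), and both sides equal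
   u (x^\<gamma>/t^2 - \<mu>/t). *)
theory Submission
  imports Defs
begin

text \<open>For t > 0 the powers of \<open>t powr (1 / \<gamma>)\<close> collapse: exponent
  \<gamma>\<mu> gives \<open>t powr \<mu>\<close> and exponent \<gamma> gives t. The product form
  suits differentiation in either variable.\<close>

lemma gen_gamma_density_tilde_eq:
  assumes "\<gamma> \<noteq> 0" "t > 0"
  shows "gen_gamma_density_tilde \<gamma> \<mu> x t =
    \<bar>\<gamma>\<bar> / Gamma \<mu> * x powr (\<gamma> * \<mu> - 1) * t powr (- \<mu>) * exp (- (x powr \<gamma> / t))"
  using assms
  by (simp add: gen_gamma_density_tilde_def gen_gamma_density_def powr_powr powr_minus field_simps)

lemma gen_gamma_density_tilde_has_derivative_t:
  assumes "\<gamma> \<noteq> 0" "t > 0"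
  shows "(gen_gamma_density_tilde \<gamma> \<mu> x has_real_derivative
    gen_gamma_density_tilde \<gamma> \<mu> x t * (x powr \<gamma> / t\<^sup>2 - \<mu> / t)) (at t)"
proof -
  \<comment> \<open>The factors depending on x are frozen as constants: \<open>b\<close> stands for
    \<open>x powr \<gamma>\<close>, \<open>c\<close> for the prefactor. The last factor is the
    derivative of -\<mu> ln s - b/s at t.\<close>
  have "((\<lambda>s. c * s powr (- \<mu>) * exp (- (b / s))) has_real_derivative
      c * t powr (- \<mu>) * exp (- (b / t)) * (b / t\<^sup>2 - \<mu> / t)) (at t)" for b c :: real
    using assms
    by (auto intro!: derivative_eq_intros simp: powr_diff field_simps power2_eq_square)
  then have "((\<lambda>s. \<bar>\<gamma>\<bar> / Gamma \<mu> * x powr (\<gamma> * \<mu> - 1) * s powr (- \<mu>) * exp (- (x powr \<gamma> / s)))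
      has_real_derivative
      gen_gamma_density_tilde \<gamma> \<mu> x t * (x powr \<gamma> / t\<^sup>2 - \<mu> / t)) (at t)"
    unfolding gen_gamma_density_tilde_eq[OF assms] .
  then show ?thesis
    \<comment> \<open>The closed form is available only for positive times, so the derivative is
      carried over on an open half-line around t.\<close>
    by (rule has_field_derivative_transform_within_open[where S = "{0<..}"])
      (use assms in \<open>auto simp: gen_gamma_density_tilde_eq\<close>)
qed

lemma gen_gamma_density_tilde_has_derivative_x:
  assumes "\<gamma> \<noteq> 0" "t > 0" "x > 0"
  shows "((\<lambda>y. gen_gamma_density_tilde \<gamma> \<mu> y t) has_real_derivative
    gen_gamma_density_tilde \<gamma> \<mu> x t * ((\<gamma> * \<mu> - 1) / x - \<gamma> * x powr \<gamma> / (x * t))) (at x)"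
proof -
  \<comment> \<open>Here t is fixed, so the closed form can be rewritten under the binder for every
    y, with a = \<gamma>\<mu> - 1 and \<open>d\<close> the power of t.\<close>
  have "((\<lambda>y. c * y powr a * d * exp (- (y powr \<gamma> / t))) has_real_derivative
      c * x powr a * d * exp (- (x powr \<gamma> / t)) * (a / x - \<gamma> * x powr \<gamma> / (x * t))) (at x)"
    for a c d :: real
    using assms
    by (auto intro!: derivative_eq_intros simp: powr_diff field_simps power2_eq_square)
  then show ?thesis
    unfolding gen_gamma_density_tilde_eq[OF assms(1,2)] .
qed

text \<open>The drift term is kept as an explicit summand so that it later cancels against the
  second term of the operator without its derivative being computed.\<close>

lemma gen_gamma_density_tilde_flux:
  assumes "\<gamma> \<noteq> 0" "t > 0" "x > 0"
  shows "x powr (2 - \<gamma>) * deriv (\<lambda>y. gen_gamma_density_tilde \<gamma> \<mu> y t) x =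
    (\<gamma> * \<mu> - 1) * (x powr (1 - \<gamma>) * gen_gamma_density_tilde \<gamma> \<mu> x t)
      - \<gamma> / t * (x * gen_gamma_density_tilde \<gamma> \<mu> x t)"
  unfolding DERIV_imp_deriv[OF gen_gamma_density_tilde_has_derivative_x[OF assms]]
  using assms by (simp add: powr_diff field_simps power2_eq_square)

theorem corollary1:
  fixes \<gamma> \<mu> :: real
  assumes "\<gamma> \<noteq> 0" and "\<mu> > 0"
  defines "u \<equiv> gen_gamma_density_tilde \<gamma> \<mu>"
  shows "\<forall>x>0. \<forall>t>0.
     (\<lambda>s. u x s) differentiable (at t) \<and>
     (\<lambda>y. u y t) differentiable (at x) \<and>
     (\<lambda>y. y powr (2 - \<gamma>) * deriv (\<lambda>z. u z t) y) differentiable (at x) \<and>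
     (\<lambda>y. y powr (1 - \<gamma>) * u y t) differentiable (at x) \<and>
     deriv (\<lambda>s. u x s) t = gen_gamma_operator \<gamma> \<mu> (\<lambda>y. u y t) x"
proof (intro allI impI)
  fix x t :: real
  assume x: "x > 0" and t: "t > 0"
  let ?D = "u x t * ((\<gamma> * \<mu> - 1) / x - \<gamma> * x powr \<gamma> / (x * t))"
  let ?F = "\<lambda>y. y powr (2 - \<gamma>) * deriv (\<lambda>z. u z t) y"
  let ?G = "\<lambda>y. y powr (1 - \<gamma>) * u y t"
  have dt: "(u x has_real_derivative u x t * (x powr \<gamma> / t\<^sup>2 - \<mu> / t)) (at t)"
    unfolding u_def by (rule gen_gamma_density_tilde_has_derivative_t[OF assms(1) t])
  have dx: "((\<lambda>y. u y t) has_real_derivative ?D) (at x)"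
    unfolding u_def by (rule gen_gamma_density_tilde_has_derivative_x[OF assms(1) t x])
  \<comment> \<open>Differentiability of \<open>?G\<close> suffices: \<open>deriv ?G x\<close> stays
    symbolic until it cancels.\<close>
  have "(\<lambda>y. y powr (1 - \<gamma>)) differentiable (at x)"
    using has_real_derivative_powr[OF x, of "1 - \<gamma>"] real_differentiable_def by blast
  moreover have "(\<lambda>y. u y t) differentiable (at x)"
    using dx real_differentiable_def by blast
  ultimately have G_diff: "?G differentiable (at x)"
    by (rule differentiable_mult)
  then have dG: "(?G has_real_derivative deriv ?G x) (at x)"
    by (simp add: DERIV_deriv_iff_real_differentiable)
  have "((\<lambda>y. (\<gamma> * \<mu> - 1) * ?G y - \<gamma> / t * (y * u y t)) has_real_derivative
      (\<gamma> * \<mu> - 1) * deriv ?G x - \<gamma> / t * (u x t + x * ?D)) (at x)"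
    by (rule derivative_eq_intros dG dx refl | simp)+
  \<comment> \<open>The flux identity holds at every y > 0, a neighbourhood of x, so it can be
    differentiated at x.\<close>
  then have dF: "(?F has_real_derivative
      (\<gamma> * \<mu> - 1) * deriv ?G x - \<gamma> / t * (u x t + x * ?D)) (at x)"
    by (rule has_field_derivative_transform_within_open[where S = "{0<..}"])
      (use x t assms(1) in \<open>auto simp: u_def gen_gamma_density_tilde_flux\<close>)
  have "gen_gamma_operator \<gamma> \<mu> (\<lambda>y. u y t) x = 1 / \<gamma>\<^sup>2 * (- (\<gamma> / t * (u x t + x * ?D)))"
    by (simp add: gen_gamma_operator_def DERIV_imp_deriv[OF dF])
  \<comment> \<open>The 1 from the product rule completes \<gamma>\<mu> - 1 to \<gamma>\<mu>, so u +
    x u' = \<gamma> u (\<mu> - x^\<gamma>/t), and both factors \<gamma> cancel against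
    1/\<gamma>^2.\<close>
  also have "\<dots> = u x t * (x powr \<gamma> / t\<^sup>2 - \<mu> / t)"
    using x t assms(1) by (simp add: field_simps power2_eq_square)
  also have "\<dots> = deriv (u x) t"
    using DERIV_imp_deriv[OF dt] by simp
  finally show "(\<lambda>s. u x s) differentiable (at t) \<and>
     (\<lambda>y. u y t) differentiable (at x) \<and> ?F differentiable (at x) \<and> ?G differentiable (at x) \<and>
     deriv (\<lambda>s. u x s) t = gen_gamma_operator \<gamma> \<mu> (\<lambda>y. u y t) x"
    using dt dx dF G_diff real_differentiable_def by auto
qed

end
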